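(* A parabolic subgroup of a finite irreducible (complex or quaternionic) reflection group is not normal unless it is the trivial subgroup.
   Context: A reflection on $V=\mathbb{C}^d$ or $V=\mathbb{H}^d$ is an invertible linear map $g$ with $\mathrm{rank}(I-g)=1$; a reflection group is a finite group generated by reflections. A subgroup of a reflection group $G$ acting on $V$ is parabolic if it is the pointwise stabiliser in $G$ of some subset of $V$ (equivalently of its linear span) that contains a nonzero vector, so that parabolic subgroups have smaller rank than $G$. *)

theory Defs
  imports "HOL-Analysis.Analysis" "HOL-Algebra.Generated_Groups"
begin

section \<open>The quaternions\<close>

codatatype quat = Quat (qRe: real) (qI: real) (qJ: real) (qK: real)

lemma quat_eq_iff:
  "x = y \<longleftrightarrow> qRe x = qRe y \<and> qI x = qI y \<and> qJ x = qJ y \<and> qK x = qK y"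
  by (auto intro: quat.expand)

instantiation quat :: ab_group_add
begin

primcorec zero_quat where
  "qRe 0 = 0" | "qI 0 = 0" | "qJ 0 = 0" | "qK 0 = 0"

primcorec plus_quat where
  "qRe (x + y) = qRe x + qRe y"
| "qI (x + y) = qI x + qI y"
| "qJ (x + y) = qJ x + qJ y"
| "qK (x + y) = qK x + qK y"

primcorec uminus_quat where
  "qRe (- x) = - qRe x"
| "qI (- x) = - qI x"
| "qJ (- x) = - qJ x"
| "qK (- x) = - qK x"

primcorec minus_quat where
  "qRe (x - y) = qRe x - qRe y"
| "qI (x - y) = qI x - qI y"
| "qJ (x - y) = qJ x - qJ y"
| "qK (x - y) = qK x - qK y"

instance
  by standard (simp_all add: quat_eq_iff)

end

instantiation quat :: ring_1
begin

primcorec one_quat where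
  "qRe 1 = 1" | "qI 1 = 0" | "qJ 1 = 0" | "qK 1 = 0"

primcorec times_quat where
  "qRe (x * y) = qRe x * qRe y - qI x * qI y - qJ x * qJ y - qK x * qK y"
| "qI (x * y) = qRe x * qI y + qI x * qRe y + qJ x * qK y - qK x * qJ y"
| "qJ (x * y) = qRe x * qJ y - qI x * qK y + qJ x * qRe y + qK x * qI y"
| "qK (x * y) = qRe x * qK y + qI x * qJ y - qJ x * qI y + qK x * qRe y"

instance
  by standard (simp_all add: quat_eq_iff algebra_simps)

end

definition quat_norm_sq :: "quat \<Rightarrow> real" where
  "quat_norm_sq x = (qRe x)\<^sup>2 + (qI x)\<^sup>2 + (qJ x)\<^sup>2 + (qK x)\<^sup>2"

lemma quat_norm_sq_eq_0_iff: "quat_norm_sq x = 0 \<longleftrightarrow> x = 0"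
  by (simp add: quat_norm_sq_def quat_eq_iff add_nonneg_eq_0_iff)

instantiation quat :: division_ring
begin

primcorec inverse_quat where
  "qRe (inverse x) = qRe x / quat_norm_sq x"
| "qI (inverse x) = - qI x / quat_norm_sq x"
| "qJ (inverse x) = - qJ x / quat_norm_sq x"
| "qK (inverse x) = - qK x / quat_norm_sq x"

definition "x div y = x * inverse y" for x y :: quat

instance
proof
  fix x y :: quat
  show "inverse 0 = (0 :: quat)"
    by (simp add: quat_eq_iff)
  show "x div y = x * inverse y"
    by (simp add: divide_quat_def)
  assume "x \<noteq> 0"
  then have nz: "quat_norm_sq x \<noteq> 0"
    by (simp add: quat_norm_sq_eq_0_iff)
  have *: "qRe x * qRe x / quat_norm_sq x + qI x * qI x / quat_norm_sq x
      + qJ x * qJ x / quat_norm_sq x + qK x * qK x / quat_norm_sq x = 1"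
    using nz
    by (simp add: add_divide_distrib [symmetric] quat_norm_sq_def power2_eq_square)
  show "inverse x * x = 1" and "x * inverse x = 1"
    using * by (simp_all add: quat_eq_iff mult.commute)
qed

end


section \<open>Linear algebra on \<open>K\<^sup>n\<close> over a division ring\<close>

text \<open>
  The locales \<^locale>\<open>module\<close> and \<^locale>\<open>vector_space\<close> require commutative scalars.  The definitions
  below transcribe theirs, with \<open>K\<^sup>n\<close> as a left \<open>K\<close>-space under \<^term>\<open>(*s)\<close>.
  The choice of side is immaterial for the quaternions, since conjugation is an isomorphism onto
  the opposite ring.  Linear maps are functions, not matrices, so that no convention for
  matrices with noncommuting entries intervenes.
\<close>

definition dr_subspace :: "('k::division_ring ^ 'n) set \<Rightarrow> bool" where
  "dr_subspace U \<longleftrightarrow>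
     0 \<in> U \<and> (\<forall>x\<in>U. \<forall>y\<in>U. x + y \<in> U) \<and> (\<forall>c. \<forall>x\<in>U. c *s x \<in> U)"

definition dr_span :: "('k::division_ring ^ 'n) set \<Rightarrow> ('k ^ 'n) set" where
  "dr_span B = {(\<Sum>a\<in>t. r a *s a) | t r. finite t \<and> t \<subseteq> B}"

definition dr_dependent :: "('k::division_ring ^ 'n) set \<Rightarrow> bool" where
  "dr_dependent B \<longleftrightarrow>
     (\<exists>t u. finite t \<and> t \<subseteq> B \<and> (\<Sum>v\<in>t. u v *s v) = 0 \<and> (\<exists>v\<in>t. u v \<noteq> 0))"

definition dr_dim :: "('k::division_ring ^ 'n) set \<Rightarrow> nat" where
  "dr_dim U =
     (if \<exists>B. \<not> dr_dependent B \<and> dr_span B = dr_span U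
      then card (SOME B. \<not> dr_dependent B \<and> dr_span B = dr_span U) else 0)"

definition dr_linear :: "('k::division_ring ^ 'n \<Rightarrow> 'k ^ 'n) \<Rightarrow> bool" where
  "dr_linear f \<longleftrightarrow> (\<forall>x y. f (x + y) = f x + f y) \<and> (\<forall>c x. f (c *s x) = c *s f x)"

definition dr_rank :: "('k::division_ring ^ 'n \<Rightarrow> 'k ^ 'n) \<Rightarrow> nat" where
  "dr_rank f = dr_dim (range f)"

lemma dr_subspace_eq_vec: "dr_subspace U \<longleftrightarrow> vec.subspace U"
  for U :: "('k::field ^ 'n) set"
  by (simp add: dr_subspace_def vec.subspace_def)

lemma dr_span_eq_vec: "dr_span B = vec.span B"
  for B :: "('k::field ^ 'n) set"
  by (simp add: dr_span_def vec.span_explicit)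

lemma dr_dependent_eq_vec: "dr_dependent B \<longleftrightarrow> vec.dependent B"
  for B :: "('k::field ^ 'n) set"
  by (simp add: dr_dependent_def vec.dependent_explicit)

lemma dr_dim_eq_vec: "dr_dim U = vec.dim U"
  for U :: "('k::field ^ 'n) set"
  by (simp only: dr_dim_def vec.dim_def dr_span_eq_vec dr_dependent_eq_vec)

lemma dr_linear_eq_vec: "dr_linear f \<longleftrightarrow> Vector_Spaces.linear (*s) (*s) f"
  for f :: "'k::field ^ 'n \<Rightarrow> 'k ^ 'n"
  by (simp add: dr_linear_def Vector_Spaces.linear_iff vec.vector_space_axioms)


section \<open>Reflection groups\<close>

definition GL :: "('k::division_ring ^ 'n \<Rightarrow> 'k ^ 'n) monoid" where
  "GL = \<lparr>carrier = {g. dr_linear g \<and> bij g}, mult = (\<circ>), one = id\<rparr>"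

lemma group_GL: "group GL"
proof (rule groupI)
  fix g :: "'k::division_ring ^ 'n \<Rightarrow> 'k ^ 'n"
  assume "g \<in> carrier GL"
  then have lin: "dr_linear g" and bij: "bij g"
    by (auto simp: GL_def)
  have sur: "g (Hilbert_Choice.inv g x) = x" for x
    using bij by (simp add: bij_is_surj surj_f_inv_f)
  have inj: "g x = g y \<Longrightarrow> x = y" for x y
    using bij by (meson bij_is_inj injD)
  have "dr_linear (Hilbert_Choice.inv g)"
    unfolding dr_linear_def
  proof safe
    fix x y show "Hilbert_Choice.inv g (x + y) = Hilbert_Choice.inv g x + Hilbert_Choice.inv g y"
      by (rule inj) (use lin in \<open>simp add: dr_linear_def sur\<close>)
  next
    fix c x show "Hilbert_Choice.inv g (c *s x) = c *s Hilbert_Choice.inv g x"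
      by (rule inj) (use lin in \<open>simp add: dr_linear_def sur\<close>)
  qed
  then show "\<exists>h\<in>carrier GL. h \<otimes>\<^bsub>GL\<^esub> g = \<one>\<^bsub>GL\<^esub>"
    using bij by (intro bexI[of _ "Hilbert_Choice.inv g"]) (auto simp: GL_def bij_imp_bij_inv bij_is_inj)
qed (auto simp: GL_def dr_linear_def bij_comp o_assoc)

definition is_reflection :: "('k::division_ring ^ 'n \<Rightarrow> 'k ^ 'n) \<Rightarrow> bool" where
  "is_reflection g \<longleftrightarrow> g \<in> carrier GL \<and> dr_rank (\<lambda>v. v - g v) = 1"

definition finite_reflection_group :: "('k::division_ring ^ 'n \<Rightarrow> 'k ^ 'n) set \<Rightarrow> bool" where
  "finite_reflection_group G \<longleftrightarrow>
     finite G \<and> (\<exists>R. (\<forall>r\<in>R. is_reflection r) \<and> G = generate GL R)"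

text \<open>\<open>K\<^sup>n\<close> is nonzero because index types are nonempty.\<close>

definition irreducible_on :: "('k::division_ring ^ 'n \<Rightarrow> 'k ^ 'n) set \<Rightarrow> bool" where
  "irreducible_on G \<longleftrightarrow>
     (\<forall>U. dr_subspace U \<and> (\<forall>g\<in>G. g ` U \<subseteq> U) \<longrightarrow> U = {0} \<or> U = UNIV)"

definition pointwise_stabiliser ::
    "('k::division_ring ^ 'n \<Rightarrow> 'k ^ 'n) set \<Rightarrow> ('k ^ 'n) set \<Rightarrow> ('k ^ 'n \<Rightarrow> 'k ^ 'n) set" where
  "pointwise_stabiliser G S = {g \<in> G. \<forall>v\<in>S. g v = v}"

definition parabolic_subgroup ::
    "('k::division_ring ^ 'n \<Rightarrow> 'k ^ 'n) set \<Rightarrow> ('k ^ 'n \<Rightarrow> 'k ^ 'n) set \<Rightarrow> bool" where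
  "parabolic_subgroup P G \<longleftrightarrow> (\<exists>S. (\<exists>v\<in>S. v \<noteq> 0) \<and> P = pointwise_stabiliser G S)"

end

theory Submission
  imports Defs
begin

text \<open>Let U be the space of vectors fixed by P. If P is normal, then for p in P and g in G
  there is q in P with pg = gq (\<open>normal_GL_commute\<close>), so p(gu) = g(qu) = gu for every u
  in U; thus G preserves U. A parabolic P fixes a nonzero vector, so U is nonzero and irreducibility
  forces U to be the whole space: every element of P is the identity. This is
  \<open>normal_parabolic_subgroup_trivial\<close>, valid over any division ring.\<close>

text \<open>The common fixed space of a normal subgroup is invariant under the whole group. For a
  parabolic subgroup it is nonzero, so irreducibility makes it the whole space.\<close>

lemma finite_reflection_group_subset_GL:
  assumes "finite_reflection_group G"
  shows "G \<subseteq> carrier GL"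
proof -
  obtain R where "\<forall>r\<in>R. is_reflection r" and "G = generate GL R"
    using assms by (auto simp: finite_reflection_group_def)
  moreover from this have "R \<subseteq> carrier GL"
    by (auto simp: is_reflection_def)
  ultimately show ?thesis
    by (simp add: group.generate_incl [OF group_GL])
qed

text \<open>Normality is used as Pg = gP rather than as closure under conjugation, so that no
  inverse has to be computed in the restricted monoid.\<close>

lemma normal_GL_commute:
  assumes "P \<lhd> GL\<lparr>carrier := G\<rparr>" "g \<in> G" "p \<in> P"
  obtains q where "q \<in> P" "p \<circ> g = g \<circ> q"
proof -
  have "P #>\<^bsub>GL\<lparr>carrier := G\<rparr>\<^esub> g = g <#\<^bsub>GL\<lparr>carrier := G\<rparr>\<^esub> P"
    using normal.coset_eq [OF assms(1)] assms(2) by simp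
  then have "p \<circ> g \<in> (\<lambda>q. g \<circ> q) ` P"
    using assms(3) by (auto simp: r_coset_def l_coset_def GL_def)
  then show thesis
    using that by blast
qed

lemma dr_subspace_fixed_space:
  assumes "\<And>p. p \<in> P \<Longrightarrow> dr_linear p"
  shows "dr_subspace {v. \<forall>p\<in>P. p v = v}"
proof -
  have add: "p (x + y) = p x + p y" and scale: "p (c *s x) = c *s p x" if "p \<in> P" for p c x y
    using assms [OF that] by (simp_all add: dr_linear_def)
  have "p 0 = 0" if "p \<in> P" for p
    using add [OF that, of 0 0] by simp
  then show ?thesis
    unfolding dr_subspace_def by (auto simp: add scale)
qed

lemma normal_parabolic_subgroup_trivial:
  assumes "G \<subseteq> carrier GL" "irreducible_on G" "parabolic_subgroup P G"
    and normal: "P \<lhd> GL\<lparr>carrier := G\<rparr>"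
  shows "P = {id}"
proof -
  define U where "U = {v. \<forall>p\<in>P. p v = v}"
  obtain S v where P: "P = pointwise_stabiliser G S" and v: "v \<in> S" "v \<noteq> 0"
    using assms(3) by (auto simp: parabolic_subgroup_def)
  have "dr_subspace U"
    unfolding U_def
    using assms(1) by (intro dr_subspace_fixed_space) (auto simp: P pointwise_stabiliser_def GL_def)
  moreover have "g ` U \<subseteq> U" if "g \<in> G" for g
  proof -
    have "p (g u) = g u" if "p \<in> P" "u \<in> U" for p u
    proof -
      obtain q where "q \<in> P" "p \<circ> g = g \<circ> q"
        using normal_GL_commute [OF normal \<open>g \<in> G\<close> \<open>p \<in> P\<close>] .
      with \<open>u \<in> U\<close> show ?thesis
        by (metis (mono_tags, lifting) U_def comp_apply mem_Collect_eq)
    qed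
    then show ?thesis
      by (auto simp: U_def)
  qed
  \<comment> \<open>S lies in U because P is its pointwise stabiliser; the nonzero v thus excludes U
    = {0}.\<close>
  moreover have "v \<in> U"
    using v by (auto simp: U_def P pointwise_stabiliser_def)
  ultimately have "U = UNIV"
    using assms(2) v(2) unfolding irreducible_on_def by blast
  then have "p = id" if "p \<in> P" for p
    using that by (auto simp: U_def fun_eq_iff)
  \<comment> \<open>So far P is only contained in {id}; being a subgroup, it is also
    nonempty.\<close>
  moreover have "id \<in> P"
    using subgroup.one_closed [OF normal_imp_subgroup [OF normal]] by (simp add: GL_def)
  ultimately show ?thesis
    by blast
qed

theorem proposition5p1:
  shows "(\<forall>G P :: (complex ^ 'n \<Rightarrow> complex ^ 'n) set.
            finite_reflection_group G \<and> irreducible_on G \<and> parabolic_subgroup P G \<and> P \<noteq> {id}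
              \<longrightarrow> \<not> P \<lhd> GL\<lparr>carrier := G\<rparr>)
       \<and> (\<forall>G P :: (quat ^ 'n \<Rightarrow> quat ^ 'n) set.
            finite_reflection_group G \<and> irreducible_on G \<and> parabolic_subgroup P G \<and> P \<noteq> {id}
              \<longrightarrow> \<not> P \<lhd> GL\<lparr>carrier := G\<rparr>)"
\<comment> \<open>The complex and quaternionic cases are two instances of the same lemma.\<close>
proof (intro conjI allI impI notI; elim conjE)
  fix G P :: "(complex ^ 'n \<Rightarrow> complex ^ 'n) set"
  assume "finite_reflection_group G" "irreducible_on G" "parabolic_subgroup P G"
    "P \<noteq> {id}" "P \<lhd> GL\<lparr>carrier := G\<rparr>"
  then show False
    by (metis normal_parabolic_subgroup_trivial finite_reflection_group_subset_GL)
next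
  fix G P :: "(quat ^ 'n \<Rightarrow> quat ^ 'n) set"
  assume "finite_reflection_group G" "irreducible_on G" "parabolic_subgroup P G"
    "P \<noteq> {id}" "P \<lhd> GL\<lparr>carrier := G\<rparr>"
  then show False
    by (metis normal_parabolic_subgroup_trivial finite_reflection_group_subset_GL)
qed

end
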